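(* Let $(M,g,Q,P)$ be a super-null Riemannian manifold equipped with an affine connection $\nabla$. If $\nabla$ is supersymmetry compatible, i.e. $\nabla_XQ=0$ for all $X\in\mathrm{Vect}(M)$, then $\nabla$ cannot be torsionless, i.e. its torsion tensor $T_\nabla$ is non-zero.
   Context: Supermanifolds are real, finite-dimensional, in the Berezin–Leites (locally ringed space) sense, $M=(|M|,\mathcal{O}_M)$; $C^\infty(M)$ is the superalgebra of global functions, $\mathrm{Vect}(M)$ the $C^\infty(M)$-module of vector fields, $\widetilde{\cdot}$ denotes $\mathbb{Z}_2$-parity, and $[X,Y]=XY-(-1)^{\widetilde X\widetilde Y}YX$ is the graded commutator. A metric $g$ on $M$ is an even, graded-symmetric, rank 2 covariant tensor, possibly degenerate; it determines a pairing $\langle X|Y\rangle$ with $\widetilde{\langle X|Y\rangle}=\widetilde X+\widetilde Y$, $\langle X|Y\rangle=(-1)^{\widetilde X\widetilde Y}\langle Y|X\rangle$, $\langle fX+Y|Z\rangle=f\langle X|Z\rangle+\langle Y|Z\rangle$. Its kernel is $\ker(g)=\{X\in\mathrm{Vect}(M) : \langle X|Y\rangle=0\ \text{for all } Y\in\mathrm{Vect}(M)\}$; $g$ is degenerate if $\ker(g)\neq\{0\}$. A super-null Riemannian manifold is a quadruple $(M,g,Q,P)$ where $M$ is a supermanifold of dimension $n|1$ ($n\ge 1$), $g$ is a degenerate (even) metric on $M$, $Q\in\mathrm{Vect}(M)$ is a non-singular odd vector field (i.e. its value in $T_mM$ is nonzero at every point $m\in|M|$) with $[Q,Q]=2P$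 for an even vector field $P$, and $\ker(g)=\mathrm{Span}\{Q\}$ (the $C^\infty(M)$-span). It is part of the setting that the rank of the kernel is constant, equal to $0|1$ (at every point $m\in |M|$ the bilinear form induced by $g$ on $T_mM$ has kernel of dimension $0|1$), and that around every point of $|M|$ there are Shander coordinates $(x^a,t,\tau)$, with $x^a,t$ even and $\tau$ odd, in which $Q=\partial_\tau+\tau\partial_t$ and $P=\partial_t$. An affine connection on $M$ is a parity-preserving map $\nabla:\mathrm{Vect}(M)\times\mathrm{Vect}(M)\to\mathrm{Vect}(M)$, $(X,Y)\mapsto\nabla_XY$, that is biadditive, satisfies $\nabla_{fX}Y=f\nabla_XY$ and $\nabla_X(fY)=X(f)Y+(-1)^{\widetilde X\widetilde f}f\nabla_XY$ for $f\in C^\infty(M)$. Its torsion tensor is $T_\nabla(X,Y)=\nabla_XY-(-1)^{\widetilde X\widetilde Y}\nabla_YX-[X,Y]$ for homogeneous $X,Y$. *)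

theory Defs
  imports
    "HOL-Analysis.Analysis"
    "HOL-Algebra.Module"
    "HOL-Library.Z2"
    "HOL-Library.Function_Algebras"
begin

section \<open>Superalgebras\<close>

definition real_field :: "real ring" where
  "real_field = \<lparr>carrier = UNIV, mult = (*), one = 1, zero = 0, add = (+)\<rparr>"

text \<open>Multiplication by $(-1)^p$. Parities live in the field \<^typ>\<open>bit\<close> with two elements.\<close>

definition ksign :: "('s, 'b) ring_scheme \<Rightarrow> bit \<Rightarrow> 's \<Rightarrow> 's" where
  "ksign A p x = (if p = 0 then x else \<ominus>\<^bsub>A\<^esub> x)"

text \<open>A real, associative, unital, supercommutative superalgebra \<open>A\<close>, with \<open>G p\<close> the subspace of
  elements homogeneous of parity \<open>p\<close>. The zero algebra is allowed.\<close>

definition superalgebra :: "(real, 's) module \<Rightarrow> (bit \<Rightarrow> 's set) \<Rightarrow> bool" where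
  "superalgebra A G \<longleftrightarrow>
     ring A \<and> Module.module real_field A \<and>
     (\<forall>c. \<forall>x\<in>carrier A. \<forall>y\<in>carrier A.
        (c \<odot>\<^bsub>A\<^esub> x) \<otimes>\<^bsub>A\<^esub> y = c \<odot>\<^bsub>A\<^esub> (x \<otimes>\<^bsub>A\<^esub> y) \<and>
        x \<otimes>\<^bsub>A\<^esub> (c \<odot>\<^bsub>A\<^esub> y) = c \<odot>\<^bsub>A\<^esub> (x \<otimes>\<^bsub>A\<^esub> y)) \<and>
     (\<forall>p. submodule (G p) real_field A) \<and>
     (\<forall>x\<in>carrier A. \<exists>!u. fst u \<in> G 0 \<and> snd u \<in> G 1 \<and> x = fst u \<oplus>\<^bsub>A\<^esub> snd u) \<and>
     \<one>\<^bsub>A\<^esub> \<in> G 0 \<and>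
     (\<forall>p q. \<forall>x\<in>G p. \<forall>y\<in>G q.
        x \<otimes>\<^bsub>A\<^esub> y \<in> G (p + q) \<and> x \<otimes>\<^bsub>A\<^esub> y = ksign A (p * q) (y \<otimes>\<^bsub>A\<^esub> x))"

definition superalgebra_hom ::
  "(real, 's) module \<Rightarrow> (bit \<Rightarrow> 's set) \<Rightarrow> (real, 't) module \<Rightarrow> (bit \<Rightarrow> 't set) \<Rightarrow> ('s \<Rightarrow> 't) set" where
  "superalgebra_hom A G B H =
     {h \<in> ring_hom A B.
        (\<forall>c. \<forall>x\<in>carrier A. h (c \<odot>\<^bsub>A\<^esub> x) = c \<odot>\<^bsub>B\<^esub> h x) \<and> (\<forall>p. h ` G p \<subseteq> H p)}"


section \<open>Superspaces\<close>

text \<open>A topological space with a sheaf of supercommutative superalgebras: \<open>sections M U\<close> is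
  $\mathcal{O}_M(U)$ with homogeneous components \<open>homog M U p\<close>, and
  \<open>restr M U V\<close> is the restriction map from $\mathcal{O}_M(U)$ to $\mathcal{O}_M(V)$ for
  \<open>V \<subseteq> U\<close>. The data carry no meaning on sets that are not open.\<close>

record ('m, 's) superspace =
  body :: "'m topology"
  sections :: "'m set \<Rightarrow> (real, 's) module"
  homog :: "'m set \<Rightarrow> bit \<Rightarrow> 's set"
  restr :: "'m set \<Rightarrow> 'm set \<Rightarrow> 's \<Rightarrow> 's"

definition superspace :: "('m, 's) superspace \<Rightarrow> bool" where
  "superspace M \<longleftrightarrow>
     (\<forall>U. openin (body M) U \<longrightarrow> superalgebra (sections M U) (homog M U)) \<and>
     (\<forall>U V. openin (body M) U \<and> openin (body M) V \<and> V \<subseteq> U \<longrightarrow>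
        restr M U V \<in> superalgebra_hom (sections M U) (homog M U) (sections M V) (homog M V)) \<and>
     (\<forall>U. openin (body M) U \<longrightarrow> (\<forall>f\<in>carrier (sections M U). restr M U U f = f)) \<and>
     (\<forall>U V W. openin (body M) U \<and> openin (body M) V \<and> openin (body M) W \<and> W \<subseteq> V \<and> V \<subseteq> U \<longrightarrow>
        (\<forall>f\<in>carrier (sections M U). restr M V W (restr M U V f) = restr M U W f)) \<and>
     (\<forall>\<U> s. (\<forall>V\<in>\<U>. openin (body M) V \<and> s V \<in> carrier (sections M V)) \<and>
        (\<forall>V\<in>\<U>. \<forall>W\<in>\<U>. restr M V (V \<inter> W) (s V) = restr M W (V \<inter> W) (s W)) \<longrightarrow>
        (\<exists>!f. f \<in> carrier (sections M (\<Union>\<U>)) \<and> (\<forall>V\<in>\<U>. restr M (\<Union>\<U>) V f = s V)))"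

definition open_subspace :: "('m, 's) superspace \<Rightarrow> 'm set \<Rightarrow> ('m, 's) superspace" where
  "open_subspace M U = M\<lparr>body := subtopology (body M) U\<rparr>"

definition preim :: "('m, 's) superspace \<Rightarrow> ('m \<Rightarrow> 'k) \<Rightarrow> 'k set \<Rightarrow> 'm set" where
  "preim M \<phi> V = {x \<in> topspace (body M). \<phi> x \<in> V}"

text \<open>An isomorphism $(\varphi, \varphi^*)$ of superspaces from \<open>M\<close> to \<open>N\<close>; \<open>\<psi> V\<close> is the
  pullback map from $\mathcal{O}_N(V)$ to $\mathcal{O}_M(\varphi^{-1}(V))$. When one side is
  locally ringed, so is the other, and the isomorphism is automatically local.\<close>

definition superspace_iso ::
  "('m, 's) superspace \<Rightarrow> ('k, 't) superspace \<Rightarrow> ('m \<Rightarrow> 'k) \<Rightarrow> ('k set \<Rightarrow> 't \<Rightarrow> 's) \<Rightarrow> bool" where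
  "superspace_iso M N \<phi> \<psi> \<longleftrightarrow>
     homeomorphic_map (body M) (body N) \<phi> \<and>
     (\<forall>V. openin (body N) V \<longrightarrow>
        \<psi> V \<in> superalgebra_hom (sections N V) (homog N V)
                 (sections M (preim M \<phi> V)) (homog M (preim M \<phi> V)) \<and>
        bij_betw (\<psi> V) (carrier (sections N V)) (carrier (sections M (preim M \<phi> V)))) \<and>
     (\<forall>V W. openin (body N) V \<and> openin (body N) W \<and> W \<subseteq> V \<longrightarrow>
        (\<forall>h\<in>carrier (sections N V).
           restr M (preim M \<phi> V) (preim M \<phi> W) (\<psi> V h) = \<psi> W (restr N V W h)))"


section \<open>Superdomains\<close>

definition partial_deriv :: "'n::finite \<Rightarrow> (real^'n \<Rightarrow> real) \<Rightarrow> real^'n \<Rightarrow> real" where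
  "partial_deriv i f x = frechet_derivative f (at x) (axis i 1)"

text \<open>Only meant for open \<open>S\<close>.\<close>

primrec Ck_on :: "nat \<Rightarrow> (real^'n::finite \<Rightarrow> real) \<Rightarrow> (real^'n) set \<Rightarrow> bool" where
  "Ck_on 0 f S \<longleftrightarrow> continuous_on S f"
| "Ck_on (Suc k) f S \<longleftrightarrow> f differentiable_on S \<and> (\<forall>i. Ck_on k (partial_deriv i f) S)"

definition Cinf_on :: "(real^'n::finite \<Rightarrow> real) \<Rightarrow> (real^'n) set \<Rightarrow> bool" where
  "Cinf_on f S \<longleftrightarrow> (\<forall>k. Ck_on k f S)"

text \<open>The superdomain of dimension $n|q$, $n$ being the cardinality of \<^typ>\<open>'n\<close>, over an open
  set \<open>W\<close> of $\mathbb{R}^n$: its sheaf is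
  $V \mapsto C^\infty(V) \otimes \Lambda(\xi_0, \dots, \xi_{q-1})$. A section is the family \<open>h\<close> of its
  coefficients in $\sum_I h_I \xi_I$, where $\xi_I = \xi_{i_1} \cdots \xi_{i_r}$ for
  $I = \{i_1 < \dots < i_r\}$; coefficients are extended by \<open>0\<close> outside \<open>V\<close>. The sign in the product
  comes from sorting $\xi_I \xi_J$.\<close>

definition superdomain_algebra ::
  "nat \<Rightarrow> (real^'n::finite) set \<Rightarrow> (real, nat set \<Rightarrow> real^'n \<Rightarrow> real) module" where
  "superdomain_algebra q V =
     \<lparr>carrier = {h. (\<forall>I. \<not> I \<subseteq> {..<q} \<longrightarrow> h I = (\<lambda>x. 0)) \<and> (\<forall>I. Cinf_on (h I) V) \<and>
                    (\<forall>I x. x \<notin> V \<longrightarrow> h I x = 0)},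
      mult = (\<lambda>h k K x. \<Sum>I\<in>Pow K.
                (-1) ^ card {(i, j). i \<in> I \<and> j \<in> K - I \<and> j < i} * h I x * k (K - I) x),
      one = (\<lambda>I x. if I = {} \<and> x \<in> V then 1 else 0),
      zero = (\<lambda>I x. 0),
      add = (\<lambda>h k I x. h I x + k I x),
      smult = (\<lambda>c h I x. c * h I x)\<rparr>"

definition superdomain ::
  "nat \<Rightarrow> (real^'n::finite) set \<Rightarrow> (real^'n, nat set \<Rightarrow> real^'n \<Rightarrow> real) superspace" where
  "superdomain q W =
     \<lparr>body = top_of_set W,
      sections = superdomain_algebra q,
      homog = (\<lambda>V p. {h \<in> carrier (superdomain_algebra q V).
                        \<forall>I. of_nat (card I) \<noteq> p \<longrightarrow> h I = (\<lambda>x. 0)}),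
      restr = (\<lambda>V V' h I x. if x \<in> V' then h I x else 0)\<rparr>"

definition odd_coord :: "(real^'n::finite) set \<Rightarrow> nat \<Rightarrow> nat set \<Rightarrow> real^'n \<Rightarrow> real" where
  "odd_coord W j = (\<lambda>I x. if I = {j} \<and> x \<in> W then 1 else 0)"

definition supercoordinates ::
  "nat \<Rightarrow> ('m, 's) superspace \<Rightarrow> 'm set \<Rightarrow> (real^'n::finite) set \<Rightarrow> ('m \<Rightarrow> real^'n) \<Rightarrow>
   ((real^'n) set \<Rightarrow> (nat set \<Rightarrow> real^'n \<Rightarrow> real) \<Rightarrow> 's) \<Rightarrow> bool" where
  "supercoordinates q M U W \<phi> \<psi> \<longleftrightarrow>
     openin (body M) U \<and> open W \<and> superspace_iso (open_subspace M U) (superdomain q W) \<phi> \<psi>"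

text \<open>Here \<open>n\<close> only passes the type \<^typ>\<open>'n\<close>: the even dimension is its cardinality.\<close>

definition supermanifold :: "'n::finite itself \<Rightarrow> nat \<Rightarrow> ('m, 's) superspace \<Rightarrow> bool" where
  "supermanifold n q M \<longleftrightarrow>
     superspace M \<and> Hausdorff_space (body M) \<and> second_countable (body M) \<and>
     (\<forall>m\<in>topspace (body M). \<exists>U (W :: (real^'n) set) \<phi> \<psi>. m \<in> U \<and> supercoordinates q M U W \<phi> \<psi>)"

abbreviation global_algebra :: "('m, 's) superspace \<Rightarrow> (real, 's) module" (\<open>C\<^sub>\<infinity>\<close>) where
  "C\<^sub>\<infinity> M \<equiv> sections M (topspace (body M))"

abbreviation global_homog :: "('m, 's) superspace \<Rightarrow> bit \<Rightarrow> 's set" where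
  "global_homog M p \<equiv> homog M (topspace (body M)) p"


section \<open>Vector fields\<close>

text \<open>Vector fields are the derivations of the structure sheaf: \<open>X U\<close> acts on $\mathcal{O}_M(U)$. They
  are \<^const>\<open>undefined\<close> outside their domain, so that equality of vector fields is equality in HOL.\<close>

type_synonym ('m, 's) vf = "'m set \<Rightarrow> 's \<Rightarrow> 's"

definition on_sections :: "('m, 's) superspace \<Rightarrow> ('m, 's) vf \<Rightarrow> ('m, 's) vf" where
  "on_sections M X =
     (\<lambda>U f. if openin (body M) U \<and> f \<in> carrier (sections M U) then X U f else undefined)"

definition homog_vect :: "('m, 's) superspace \<Rightarrow> bit \<Rightarrow> ('m, 's) vf set" where
  "homog_vect M p =
     {X. on_sections M X = X \<and>
       (\<forall>U. openin (body M) U \<longrightarrow>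
          (\<forall>f\<in>carrier (sections M U). X U f \<in> carrier (sections M U)) \<and>
          (\<forall>f\<in>carrier (sections M U). \<forall>g\<in>carrier (sections M U).
             X U (f \<oplus>\<^bsub>sections M U\<^esub> g) = X U f \<oplus>\<^bsub>sections M U\<^esub> X U g) \<and>
          (\<forall>c. \<forall>f\<in>carrier (sections M U). X U (c \<odot>\<^bsub>sections M U\<^esub> f) = c \<odot>\<^bsub>sections M U\<^esub> X U f) \<and>
          (\<forall>a. \<forall>f\<in>homog M U a. X U f \<in> homog M U (p + a)) \<and>
          (\<forall>a. \<forall>f\<in>homog M U a. \<forall>g\<in>carrier (sections M U).
             X U (f \<otimes>\<^bsub>sections M U\<^esub> g) =
               X U f \<otimes>\<^bsub>sections M U\<^esub> g \<oplus>\<^bsub>sections M U\<^esub>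
               ksign (sections M U) (p * a) (f \<otimes>\<^bsub>sections M U\<^esub> X U g))) \<and>
       (\<forall>U V. openin (body M) U \<and> openin (body M) V \<and> V \<subseteq> U \<longrightarrow>
          (\<forall>f\<in>carrier (sections M U). restr M U V (X U f) = X V (restr M U V f)))}"

definition vf_zero :: "('m, 's) superspace \<Rightarrow> ('m, 's) vf" where
  "vf_zero M = on_sections M (\<lambda>U f. \<zero>\<^bsub>sections M U\<^esub>)"

definition vf_add :: "('m, 's) superspace \<Rightarrow> ('m, 's) vf \<Rightarrow> ('m, 's) vf \<Rightarrow> ('m, 's) vf" where
  "vf_add M X Y = on_sections M (\<lambda>U f. X U f \<oplus>\<^bsub>sections M U\<^esub> Y U f)"

definition vf_diff :: "('m, 's) superspace \<Rightarrow> ('m, 's) vf \<Rightarrow> ('m, 's) vf \<Rightarrow> ('m, 's) vf" where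
  "vf_diff M X Y = on_sections M (\<lambda>U f. X U f \<ominus>\<^bsub>sections M U\<^esub> Y U f)"

definition vf_ksign :: "('m, 's) superspace \<Rightarrow> bit \<Rightarrow> ('m, 's) vf \<Rightarrow> ('m, 's) vf" where
  "vf_ksign M p X = on_sections M (\<lambda>U f. ksign (sections M U) p (X U f))"

definition vf_comp :: "('m, 's) superspace \<Rightarrow> ('m, 's) vf \<Rightarrow> ('m, 's) vf \<Rightarrow> ('m, 's) vf" where
  "vf_comp M X Y = on_sections M (\<lambda>U f. X U (Y U f))"

definition vf_smult :: "('m, 's) superspace \<Rightarrow> 's \<Rightarrow> ('m, 's) vf \<Rightarrow> ('m, 's) vf" where
  "vf_smult M h X = on_sections M (\<lambda>U f. restr M (topspace (body M)) U h \<otimes>\<^bsub>sections M U\<^esub> X U f)"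

definition vf_apply :: "('m, 's) superspace \<Rightarrow> ('m, 's) vf \<Rightarrow> 's \<Rightarrow> 's" where
  "vf_apply M X f = X (topspace (body M)) f"

definition Vect :: "('m, 's) superspace \<Rightarrow> ('m, 's) vf set" where
  "Vect M = {vf_add M X Y | X Y. X \<in> homog_vect M 0 \<and> Y \<in> homog_vect M 1}"

definition vf_span :: "('m, 's) superspace \<Rightarrow> ('m, 's) vf \<Rightarrow> ('m, 's) vf set" where
  "vf_span M X = {vf_smult M f X | f. f \<in> carrier (C\<^sub>\<infinity> M)}"

text \<open>The graded commutator of vector fields of parities \<open>a\<close> and \<open>b\<close>.\<close>

definition vf_bracket ::
  "('m, 's) superspace \<Rightarrow> bit \<Rightarrow> bit \<Rightarrow> ('m, 's) vf \<Rightarrow> ('m, 's) vf \<Rightarrow> ('m, 's) vf" where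
  "vf_bracket M a b X Y = vf_diff M (vf_comp M X Y) (vf_ksign M (a * b) (vf_comp M Y X))"

text \<open>The coordinate vector fields of a superdomain; the odd one acts from the left.\<close>

definition d_even :: "nat \<Rightarrow> (real^'n::finite) set \<Rightarrow> 'n \<Rightarrow>
    (real^'n, nat set \<Rightarrow> real^'n \<Rightarrow> real) vf" where
  "d_even q W i = on_sections (superdomain q W)
     (\<lambda>V h I x. if x \<in> V then partial_deriv i (h I) x else 0)"

definition d_odd :: "nat \<Rightarrow> (real^'n::finite) set \<Rightarrow> nat \<Rightarrow>
    (real^'n, nat set \<Rightarrow> real^'n \<Rightarrow> real) vf" where
  "d_odd q W j = on_sections (superdomain q W)
     (\<lambda>V h I x. if j \<in> I then 0 else (-1) ^ card {i \<in> I. i < j} * h (insert j I) x)"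

text \<open>In the coordinates \<open>\<phi>\<close>, \<open>\<psi>\<close> on \<open>U\<close>, the vector field \<open>X\<close> on \<open>M\<close> is given by \<open>Y\<close> on the
  superdomain over \<open>W\<close>.\<close>

definition vf_in_coordinates ::
  "('m, 's) superspace \<Rightarrow> 'm set \<Rightarrow> (real^'n) set \<Rightarrow> ('m \<Rightarrow> real^'n) \<Rightarrow>
   ((real^'n::finite) set \<Rightarrow> (nat set \<Rightarrow> real^'n \<Rightarrow> real) \<Rightarrow> 's) \<Rightarrow> nat \<Rightarrow>
   ('m, 's) vf \<Rightarrow> (real^'n, nat set \<Rightarrow> real^'n \<Rightarrow> real) vf \<Rightarrow> bool" where
  "vf_in_coordinates M U W \<phi> \<psi> q X Y \<longleftrightarrow>
     (\<forall>V. openin (body (superdomain q W)) V \<longrightarrow>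
        (\<forall>h\<in>carrier (sections (superdomain q W) V).
           X (preim (open_subspace M U) \<phi> V) (\<psi> V h) = \<psi> V (Y V h)))"


section \<open>Tangent spaces\<close>

text \<open>The value $f(m)$ of a section at a point is the unique real $c$ such that $f - c$ is not
  invertible in any neighbourhood of $m$.\<close>

definition value_at :: "('m, 's) superspace \<Rightarrow> 'm \<Rightarrow> 'm set \<Rightarrow> 's \<Rightarrow> real" where
  "value_at M m U f =
     (THE c. \<forall>V. openin (body M) V \<and> m \<in> V \<and> V \<subseteq> U \<longrightarrow>
        restr M U V f \<ominus>\<^bsub>sections M V\<^esub> (c \<odot>\<^bsub>sections M V\<^esub> \<one>\<^bsub>sections M V\<^esub>)
          \<notin> Units (sections M V))"

text \<open>Tangent vectors at $m$ are derivations $\mathcal{O}_{M,m} \to \mathbb{R}$. A function on the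
  stalk is encoded as a function of a neighbourhood \<open>U\<close> of \<open>m\<close> and a section over \<open>U\<close> that is
  compatible with restriction; it is \<open>0\<close> outside this domain.\<close>

definition at_point :: "('m, 's) superspace \<Rightarrow> 'm \<Rightarrow> ('m set \<Rightarrow> 's \<Rightarrow> real) \<Rightarrow> 'm set \<Rightarrow> 's \<Rightarrow> real" where
  "at_point M m v =
     (\<lambda>U f. if openin (body M) U \<and> m \<in> U \<and> f \<in> carrier (sections M U) then v U f else 0)"

definition homog_tangent :: "('m, 's) superspace \<Rightarrow> 'm \<Rightarrow> bit \<Rightarrow> ('m set \<Rightarrow> 's \<Rightarrow> real) set" where
  "homog_tangent M m p =
     {v. at_point M m v = v \<and>
       (\<forall>U. openin (body M) U \<and> m \<in> U \<longrightarrow>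
          (\<forall>f\<in>carrier (sections M U). \<forall>g\<in>carrier (sections M U).
             v U (f \<oplus>\<^bsub>sections M U\<^esub> g) = v U f + v U g) \<and>
          (\<forall>c. \<forall>f\<in>carrier (sections M U). v U (c \<odot>\<^bsub>sections M U\<^esub> f) = c * v U f) \<and>
          (\<forall>a. \<forall>f\<in>homog M U a. a \<noteq> p \<longrightarrow> v U f = 0) \<and>
          (\<forall>a. \<forall>f\<in>homog M U a. \<forall>g\<in>carrier (sections M U).
             v U (f \<otimes>\<^bsub>sections M U\<^esub> g) =
               v U f * value_at M m U g +
               (if p * a = 0 then 1 else -1) * value_at M m U f * v U g)) \<and>
       (\<forall>U V. openin (body M) U \<and> openin (body M) V \<and> m \<in> V \<and> V \<subseteq> U \<longrightarrow>
          (\<forall>f\<in>carrier (sections M U). v U f = v V (restr M U V f)))}"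

definition tangent :: "('m, 's) superspace \<Rightarrow> 'm \<Rightarrow> ('m set \<Rightarrow> 's \<Rightarrow> real) set" where
  "tangent M m = {v + w | v w. v \<in> homog_tangent M m 0 \<and> w \<in> homog_tangent M m 1}"

definition vf_value :: "('m, 's) superspace \<Rightarrow> 'm \<Rightarrow> ('m, 's) vf \<Rightarrow> 'm set \<Rightarrow> 's \<Rightarrow> real" where
  "vf_value M m X = at_point M m (\<lambda>U f. value_at M m U (X U f))"

definition nonsingular :: "('m, 's) superspace \<Rightarrow> ('m, 's) vf \<Rightarrow> bool" where
  "nonsingular M X \<longleftrightarrow> (\<forall>m\<in>topspace (body M). vf_value M m X \<noteq> 0)"

abbreviation (input) tangent_scale :: "real \<Rightarrow> ('m set \<Rightarrow> 's \<Rightarrow> real) \<Rightarrow> 'm set \<Rightarrow> 's \<Rightarrow> real" where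
  "tangent_scale c v \<equiv> (\<lambda>U f. c * v U f)"

definition has_superdim ::
  "('m, 's) superspace \<Rightarrow> 'm \<Rightarrow> ('m set \<Rightarrow> 's \<Rightarrow> real) set \<Rightarrow> nat \<Rightarrow> nat \<Rightarrow> bool" where
  "has_superdim M m K p q \<longleftrightarrow>
     (\<exists>B\<^sub>0 B\<^sub>1. finite B\<^sub>0 \<and> card B\<^sub>0 = p \<and> B\<^sub>0 \<subseteq> homog_tangent M m 0 \<and>
              finite B\<^sub>1 \<and> card B\<^sub>1 = q \<and> B\<^sub>1 \<subseteq> homog_tangent M m 1 \<and>
              \<not> Modules.module.dependent tangent_scale (B\<^sub>0 \<union> B\<^sub>1) \<and>
              Modules.module.span tangent_scale (B\<^sub>0 \<union> B\<^sub>1) = K)"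


section \<open>Metrics and connections\<close>

text \<open>A possibly degenerate even metric, given by its pairing $\langle X|Y\rangle$.\<close>

definition metric :: "('m, 's) superspace \<Rightarrow> (('m, 's) vf \<Rightarrow> ('m, 's) vf \<Rightarrow> 's) \<Rightarrow> bool" where
  "metric M g \<longleftrightarrow>
     (\<forall>X\<in>Vect M. \<forall>Y\<in>Vect M. g X Y \<in> carrier (C\<^sub>\<infinity> M)) \<and>
     (\<forall>a b. \<forall>X\<in>homog_vect M a. \<forall>Y\<in>homog_vect M b.
        g X Y \<in> global_homog M (a + b) \<and> g X Y = ksign (C\<^sub>\<infinity> M) (a * b) (g Y X)) \<and>
     (\<forall>f\<in>carrier (C\<^sub>\<infinity> M). \<forall>X\<in>Vect M. \<forall>Y\<in>Vect M. \<forall>Z\<in>Vect M.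
        g (vf_add M (vf_smult M f X) Y) Z = f \<otimes>\<^bsub>C\<^sub>\<infinity> M\<^esub> g X Z \<oplus>\<^bsub>C\<^sub>\<infinity> M\<^esub> g Y Z \<and>
        g Z (vf_add M X Y) = g Z X \<oplus>\<^bsub>C\<^sub>\<infinity> M\<^esub> g Z Y)"

definition metric_ker ::
  "('m, 's) superspace \<Rightarrow> (('m, 's) vf \<Rightarrow> ('m, 's) vf \<Rightarrow> 's) \<Rightarrow> ('m, 's) vf set" where
  "metric_ker M g = {X \<in> Vect M. \<forall>Y\<in>Vect M. g X Y = \<zero>\<^bsub>C\<^sub>\<infinity> M\<^esub>}"

text \<open>The form induced by \<open>g\<close> on the tangent space at \<open>m\<close>. It is well defined because every tangent
  vector extends to a vector field and \<open>g\<close> is tensorial.\<close>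

definition metric_at ::
  "('m, 's) superspace \<Rightarrow> (('m, 's) vf \<Rightarrow> ('m, 's) vf \<Rightarrow> 's) \<Rightarrow> 'm \<Rightarrow>
   ('m set \<Rightarrow> 's \<Rightarrow> real) \<Rightarrow> ('m set \<Rightarrow> 's \<Rightarrow> real) \<Rightarrow> real" where
  "metric_at M g m v w =
     (THE r. \<exists>X\<in>Vect M. \<exists>Y\<in>Vect M. vf_value M m X = v \<and> vf_value M m Y = w \<and>
        r = value_at M m (topspace (body M)) (g X Y))"

definition metric_ker_at ::
  "('m, 's) superspace \<Rightarrow> (('m, 's) vf \<Rightarrow> ('m, 's) vf \<Rightarrow> 's) \<Rightarrow> 'm \<Rightarrow> ('m set \<Rightarrow> 's \<Rightarrow> real) set" where
  "metric_ker_at M g m = {v \<in> tangent M m. \<forall>w\<in>tangent M m. metric_at M g m v w = 0}"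

text \<open>The even coordinates are indexed by \<^typ>\<open>'n\<close>; one of them, of index \<open>t\<close>, is singled out. The odd
  coordinate is $\tau = \xi_0$.\<close>

definition shander_around ::
  "'n::finite itself \<Rightarrow> ('m, 's) superspace \<Rightarrow> ('m, 's) vf \<Rightarrow> ('m, 's) vf \<Rightarrow> 'm \<Rightarrow> bool" where
  "shander_around n M Q P m \<longleftrightarrow>
     (\<exists>U (W :: (real^'n) set) \<phi> \<psi> t. m \<in> U \<and> supercoordinates 1 M U W \<phi> \<psi> \<and>
        vf_in_coordinates M U W \<phi> \<psi> 1 Q
          (vf_add (superdomain 1 W) (d_odd 1 W 0)
             (vf_smult (superdomain 1 W) (odd_coord W 0) (d_even 1 W t))) \<and>
        vf_in_coordinates M U W \<phi> \<psi> 1 P (d_even 1 W t))"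

definition super_null_riemannian ::
  "'n::finite itself \<Rightarrow> ('m, 's) superspace \<Rightarrow> (('m, 's) vf \<Rightarrow> ('m, 's) vf \<Rightarrow> 's) \<Rightarrow>
   ('m, 's) vf \<Rightarrow> ('m, 's) vf \<Rightarrow> bool" where
  "super_null_riemannian n M g Q P \<longleftrightarrow>
     supermanifold n 1 M \<and>
     metric M g \<and> metric_ker M g \<noteq> {vf_zero M} \<and>
     Q \<in> homog_vect M 1 \<and> nonsingular M Q \<and>
     P \<in> homog_vect M 0 \<and> vf_bracket M 1 1 Q Q = vf_add M P P \<and>
     metric_ker M g = vf_span M Q \<and>
     (\<forall>m\<in>topspace (body M). has_superdim M m (metric_ker_at M g m) 0 1) \<and>
     (\<forall>m\<in>topspace (body M). shander_around n M Q P m)"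

definition affine_connection ::
  "('m, 's) superspace \<Rightarrow> (('m, 's) vf \<Rightarrow> ('m, 's) vf \<Rightarrow> ('m, 's) vf) \<Rightarrow> bool" where
  "affine_connection M nabla \<longleftrightarrow>
     (\<forall>X\<in>Vect M. \<forall>Y\<in>Vect M. nabla X Y \<in> Vect M) \<and>
     (\<forall>a b. \<forall>X\<in>homog_vect M a. \<forall>Y\<in>homog_vect M b. nabla X Y \<in> homog_vect M (a + b)) \<and>
     (\<forall>X\<in>Vect M. \<forall>Y\<in>Vect M. \<forall>Z\<in>Vect M.
        nabla (vf_add M X Y) Z = vf_add M (nabla X Z) (nabla Y Z) \<and>
        nabla X (vf_add M Y Z) = vf_add M (nabla X Y) (nabla X Z)) \<and>
     (\<forall>f\<in>carrier (C\<^sub>\<infinity> M). \<forall>X\<in>Vect M. \<forall>Y\<in>Vect M.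
        nabla (vf_smult M f X) Y = vf_smult M f (nabla X Y)) \<and>
     (\<forall>a b. \<forall>f\<in>global_homog M a. \<forall>X\<in>homog_vect M b. \<forall>Y\<in>Vect M.
        nabla X (vf_smult M f Y) =
          vf_add M (vf_smult M (vf_apply M X f) Y)
                   (vf_ksign M (b * a) (vf_smult M f (nabla X Y))))"

definition supersymmetry_compatible ::
  "('m, 's) superspace \<Rightarrow> ('m, 's) vf \<Rightarrow> (('m, 's) vf \<Rightarrow> ('m, 's) vf \<Rightarrow> ('m, 's) vf) \<Rightarrow> bool" where
  "supersymmetry_compatible M Q nabla \<longleftrightarrow> (\<forall>X\<in>Vect M. nabla X Q = vf_zero M)"

text \<open>The torsion on vector fields of parities \<open>a\<close> and \<open>b\<close>. As it is biadditive, the torsion tensor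
  vanishes iff it vanishes on homogeneous arguments.\<close>

definition torsion ::
  "('m, 's) superspace \<Rightarrow> (('m, 's) vf \<Rightarrow> ('m, 's) vf \<Rightarrow> ('m, 's) vf) \<Rightarrow> bit \<Rightarrow> bit \<Rightarrow>
   ('m, 's) vf \<Rightarrow> ('m, 's) vf \<Rightarrow> ('m, 's) vf" where
  "torsion M nabla a b X Y =
     vf_diff M (vf_diff M (nabla X Y) (vf_ksign M (a * b) (nabla Y X))) (vf_bracket M a b X Y)"

definition torsionless ::
  "('m, 's) superspace \<Rightarrow> (('m, 's) vf \<Rightarrow> ('m, 's) vf \<Rightarrow> ('m, 's) vf) \<Rightarrow> bool" where
  "torsionless M nabla \<longleftrightarrow>
     (\<forall>a b. \<forall>X\<in>homog_vect M a. \<forall>Y\<in>homog_vect M b. torsion M nabla a b X Y = vf_zero M)"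

end

theory Submission
  imports Defs
begin

text \<open>The torsion on the pair \<open>(Q, Q)\<close> is \<open>2 \<nabla>\<^sub>Q Q - [Q, Q] = -2P\<close> for a supersymmetry
  compatible connection, and in Shander coordinates \<open>P = \<partial>\<^sub>t\<close> maps the coordinate
  \<open>t\<close> to \<open>1\<close>. Shander coordinates exist because the body is not empty: over the empty set the sheaf
  condition leaves only one vector field, and the metric could not be degenerate.\<close>

section \<open>Smooth functions and the purely even sections of a superdomain\<close>

lemma Ck_on_cong:
  assumes "open S" and "\<And>x. x \<in> S \<Longrightarrow> f x = g x"
  shows "Ck_on k f S \<longleftrightarrow> Ck_on k g S"
  using assms(2)
proof (induction k arbitrary: f g)
  case 0
  then show ?case by (auto intro: continuous_on_cong)
next
  case (Suc k)
  \<comment> \<open>Since \<open>S\<close> is a neighbourhood of each of its points, the values on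
    \<open>S\<close> alone determine differentiability and the derivative there.\<close>
  have aux: "a differentiable (at x) \<Longrightarrow> b differentiable (at x) \<and>
      frechet_derivative a (at x) = frechet_derivative b (at x)"
    if "x \<in> S" and "\<And>y. y \<in> S \<Longrightarrow> a y = b y" for a b :: "real^'a \<Rightarrow> real" and x
  proof
    assume d: "a differentiable (at x)"
    then have "(a has_derivative frechet_derivative a (at x)) (at x)"
      by (simp add: frechet_derivative_works)
    then have "(b has_derivative frechet_derivative a (at x)) (at x)"
      by (rule has_derivative_transform_within_open[OF _ assms(1) that(1)]) (use that in auto)
    then show "b differentiable (at x)"
      and "frechet_derivative a (at x) = frechet_derivative b (at x)"
      using frechet_derivative_at differentiable_def by blast+
  qed
  have diff: "f differentiable_on S \<longleftrightarrow> g differentiable_on S"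
    unfolding differentiable_on_eq_differentiable_at[OF assms(1)]
    using aux[of _ f g] aux[of _ g f] Suc.prems by metis
  show ?case
  proof (cases "f differentiable_on S")
    case True
    have "partial_deriv i f x = partial_deriv i g x" if "x \<in> S" for i x
      using aux[of x f g] that True Suc.prems
      by (simp add: partial_deriv_def differentiable_on_eq_differentiable_at[OF assms(1)])
    \<comment> \<open>The partial derivatives are known to agree on \<open>S\<close> only, not as
      functions on the whole space; this is why the induction generalises over \<open>f\<close> and
      \<open>g\<close>.\<close>
    then have "Ck_on k (partial_deriv i f) S \<longleftrightarrow> Ck_on k (partial_deriv i g) S" for i
      by (rule Suc.IH)
    then show ?thesis using diff by simp
  qed (use diff in simp)
qed

lemma Cinf_on_cong:
  assumes "open S" and "\<And>x. x \<in> S \<Longrightarrow> f x = g x"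
  shows "Cinf_on f S \<longleftrightarrow> Cinf_on g S"
  using Ck_on_cong[OF assms] by (simp add: Cinf_on_def)

lemma Cinf_on_const: "Cinf_on (\<lambda>x. c) S"
proof -
  have "Ck_on k (\<lambda>x. c) S" for k
    by (induction k arbitrary: c) (simp_all add: partial_deriv_def[abs_def])
  then show ?thesis by (simp add: Cinf_on_def)
qed

lemma partial_deriv_coordinate: "partial_deriv i (\<lambda>x. x $ j) x = (if i = j then 1 else 0)"
proof -
  have "((\<lambda>x::real^'a. x $ j) has_derivative (\<lambda>x. x $ j)) (at x)"
    by (rule bounded_linear_imp_has_derivative) (rule bounded_linear_vec_nth)
  then have "frechet_derivative (\<lambda>x::real^'a. x $ j) (at x) = (\<lambda>x. x $ j)"
    by (rule frechet_derivative_at[symmetric])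
  then show ?thesis by (simp add: partial_deriv_def axis_def)
qed

text \<open>All first partial derivatives are constant, so a case split on the order reduces the
  claim to constants and no induction is required.\<close>

lemma Cinf_on_coordinate: "Cinf_on (\<lambda>x::real^'n::finite. x $ j) S"
proof -
  have "Ck_on k (\<lambda>x::real^'n. x $ j) S" for k
  proof (cases k)
    case (Suc l)
    have "partial_deriv i (\<lambda>x. x $ j) = (\<lambda>x. if i = j then 1 else 0)" for i :: 'n
      by (rule ext) (rule partial_deriv_coordinate)
    moreover have "(\<lambda>x::real^'n. x $ j) differentiable_on S"
      by (intro linear_imp_differentiable_on bounded_linear.linear bounded_linear_vec_nth)
    ultimately show ?thesis
      using Cinf_on_const[where S = S] by (simp add: Suc Cinf_on_def)
  qed (simp add: continuous_on_component)
  then show ?thesis by (simp add: Cinf_on_def)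
qed

text \<open>A function of the even coordinates as a section: its only coefficient belongs to the
  empty monomial. The cut-off outside \<open>W\<close> is what the carrier of
  \<open>superdomain_algebra\<close> demands.\<close>

definition even_section :: "(real^'n::finite) set \<Rightarrow> (real^'n \<Rightarrow> real) \<Rightarrow> nat set \<Rightarrow> real^'n \<Rightarrow> real" where
  "even_section W f = (\<lambda>I x. if I = {} \<and> x \<in> W then f x else 0)"

lemma even_section_closed:
  assumes "open W" and "Cinf_on f W"
  shows "even_section W f \<in> carrier (superdomain_algebra q W)"
proof -
  have "Cinf_on (even_section W f I) W" for I
  proof (cases "I = {}")
    case True
    \<comment> \<open>The cut-off may create jumps at the boundary of \<open>W\<close>, but
      smoothness is asked for on the open set \<open>W\<close> only.\<close>
    have "Cinf_on (even_section W f I) W \<longleftrightarrow> Cinf_on f W"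
      using assms(1) True by (intro Cinf_on_cong) (auto simp: even_section_def)
    then show ?thesis using assms(2) by simp
  next
    case False
    then show ?thesis using Cinf_on_const[of 0 W] by (simp add: even_section_def)
  qed
  then show ?thesis by (auto simp: superdomain_algebra_def even_section_def)
qed

text \<open>Near a point of the open set \<open>W\<close> the cut-off is invisible to the
  derivative, and the coefficients of nonempty monomials vanish identically.\<close>

lemma d_even_even_section:
  fixes W :: "(real^'n::finite) set"
  assumes "open W" and "Cinf_on f W"
  shows "d_even q W i W (even_section W f) = even_section W (partial_deriv i f)"
proof -
  have "partial_deriv i (even_section W f {}) x = partial_deriv i f x" if "x \<in> W" for x
  proof -
    have "f differentiable (at x)"
      using assms that spec[where x = "Suc 0", OF assms(2)[unfolded Cinf_on_def]]
      by (simp add: differentiable_on_eq_differentiable_at)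
    then have "(f has_derivative frechet_derivative f (at x)) (at x)"
      by (simp add: frechet_derivative_works)
    then have "(even_section W f {} has_derivative frechet_derivative f (at x)) (at x)"
      by (rule has_derivative_transform_within_open[OF _ assms(1) that])
        (simp add: even_section_def)
    then have "frechet_derivative (even_section W f {}) (at x) = frechet_derivative f (at x)"
      by (rule frechet_derivative_at[symmetric])
    then show ?thesis by (simp add: partial_deriv_def)
  qed
  moreover have "partial_deriv i (even_section W f I) x = 0" if "I \<noteq> {}" for I x
    using that by (simp add: even_section_def partial_deriv_def)
  ultimately show ?thesis
    using even_section_closed[OF assms]
    by (intro ext) (auto simp: d_even_def on_sections_def superdomain_def even_section_def)
qed

section \<open>Superspaces, their vector fields and coordinates\<close>

lemma superspace_superalgebra:
  "superspace M \<Longrightarrow> openin (body M) U \<Longrightarrow> superalgebra (sections M U) (homog M U)"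
  by (simp add: superspace_def)

lemma superspace_ring: "superspace M \<Longrightarrow> openin (body M) U \<Longrightarrow> ring (sections M U)"
  using superspace_superalgebra[of M U] by (simp add: superalgebra_def)

text \<open>The empty family covers the empty set, and gluing it yields exactly one section.\<close>

lemma superspace_sections_empty:
  assumes "superspace M"
    and "x \<in> carrier (sections M {})" and "y \<in> carrier (sections M {})"
  shows "x = y"
proof -
  have "(\<forall>V\<in>\<U>. openin (body M) V \<and> s V \<in> carrier (sections M V)) \<and>
        (\<forall>V\<in>\<U>. \<forall>W\<in>\<U>. restr M V (V \<inter> W) (s V) = restr M W (V \<inter> W) (s W)) \<longrightarrow>
        (\<exists>!f. f \<in> carrier (sections M (\<Union>\<U>)) \<and> (\<forall>V\<in>\<U>. restr M (\<Union>\<U>) V f = s V))" for \<U> s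
    by (rule assms(1)[unfolded superspace_def, THEN conjunct2, THEN conjunct2, THEN conjunct2,
          THEN conjunct2, THEN spec, THEN spec])
  from this[of "{}" "\<lambda>_. undefined"] have "\<exists>!f. f \<in> carrier (sections M {})" by simp
  then show ?thesis using assms(2,3) by blast
qed

lemma homog_vect_closed:
  "X \<in> homog_vect M p \<Longrightarrow> openin (body M) U \<Longrightarrow> f \<in> carrier (sections M U) \<Longrightarrow>
    X U f \<in> carrier (sections M U)"
  by (simp add: homog_vect_def)

text \<open>Restriction maps preserve the unit, so \<open>X\<close> is one times itself. For
  \<open>Q\<close> this gives membership in the kernel of the metric, and thereby in
  \<open>Vect M\<close>, without splitting it into parities.\<close>

lemma homog_vect_in_span:
  assumes "superspace M" and "X \<in> homog_vect M p"
  shows "X \<in> vf_span M X"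
proof -
  let ?T = "topspace (body M)"
  interpret T: ring "C\<^sub>\<infinity> M" using assms(1) by (intro superspace_ring) auto
  have "restr M ?T U \<one>\<^bsub>C\<^sub>\<infinity> M\<^esub> \<otimes>\<^bsub>sections M U\<^esub> X U f = X U f"
    if "openin (body M) U" and "f \<in> carrier (sections M U)" for U f
  proof -
    interpret ring "sections M U" using assms(1) that(1) by (rule superspace_ring)
    have "restr M ?T U \<in> ring_hom (C\<^sub>\<infinity> M) (sections M U)"
      using assms(1) that(1) openin_subset[OF that(1)]
      by (auto simp: superspace_def superalgebra_hom_def)
    then have "restr M ?T U \<one>\<^bsub>C\<^sub>\<infinity> M\<^esub> = \<one>\<^bsub>sections M U\<^esub>" by (rule ring_hom_one)
    then show ?thesis using homog_vect_closed[OF assms(2) that] by simp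
  qed
  then have "vf_smult M \<one>\<^bsub>C\<^sub>\<infinity> M\<^esub> X = on_sections M X"
    unfolding vf_smult_def on_sections_def by (intro ext) simp
  also have "\<dots> = X" using assms(2) by (simp add: homog_vect_def)
  finally show ?thesis unfolding vf_span_def by (auto intro!: exI[of _ "\<one>\<^bsub>C\<^sub>\<infinity> M\<^esub>"])
qed

text \<open>Every open set is then empty and carries a single section, so all multiples of
  \<open>X\<close> take the value zero; off the domain both sides are \<open>undefined\<close>.
  Applied to \<open>Q\<close>, this contradicts degeneracy of the metric.\<close>

lemma vf_span_empty_body:
  assumes "superspace M" and "topspace (body M) = {}" and "X \<in> homog_vect M p"
  shows "vf_span M X = {vf_zero M}"
proof -
  have "openin (body M) {}" by simp
  then interpret ring "sections M {}" using assms(1) by (intro superspace_ring)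
  have "vf_smult M f X = vf_zero M" if f: "f \<in> carrier (C\<^sub>\<infinity> M)" for f
  proof (intro ext)
    fix U h
    show "vf_smult M f X U h = vf_zero M U h"
    proof (cases "openin (body M) U \<and> h \<in> carrier (sections M U)")
      case True
      then have U: "U = {}" using assms(2) openin_subset by fastforce
      have "restr M {} {} f = f"
        using assms(1,2) f \<open>openin (body M) {}\<close> by (simp add: superspace_def)
      then have "restr M {} {} f \<otimes>\<^bsub>sections M {}\<^esub> X {} h \<in> carrier (sections M {})"
        using f assms(2) homog_vect_closed[OF assms(3)] True U by simp
      then have "restr M {} {} f \<otimes>\<^bsub>sections M {}\<^esub> X {} h = \<zero>\<^bsub>sections M {}\<^esub>"
        by (intro superspace_sections_empty[OF assms(1)]) auto
      then show ?thesis
        using True U assms(2) by (simp add: vf_smult_def vf_zero_def on_sections_def)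
    qed (auto simp: vf_smult_def vf_zero_def on_sections_def)
  qed
  then have "vf_span M X \<subseteq> {vf_zero M}" by (auto simp: vf_span_def)
  then show ?thesis using homog_vect_in_span[OF assms(1,3)] by blast
qed

text \<open>The witness is the coordinate \<open>t\<close> pulled back to \<open>U\<close>:
  \<open>P\<close> sends it to one, and the constants two and zero stay distinct under the injective
  \<open>\<psi> W\<close>. Working with the double, which is what the torsion produces, avoids
  dividing by two.\<close>

lemma supercoordinates_d_even_double_nonzero:
  fixes W :: "(real^'n::finite) set"
  assumes "superspace M" and coords: "supercoordinates q M U W \<phi> \<psi>" and "U \<noteq> {}"
    and P: "vf_in_coordinates M U W \<phi> \<psi> q P (d_even q W t)"
  obtains f where "f \<in> carrier (sections M U)"
    and "P U f \<oplus>\<^bsub>sections M U\<^esub> P U f \<noteq> \<zero>\<^bsub>sections M U\<^esub>"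
proof -
  let ?A = "sections M U" and ?B = "superdomain_algebra q W"
  let ?f = "even_section W (\<lambda>x. x $ t)" and ?e = "\<lambda>c. even_section W (\<lambda>x. c)"
  from coords have oU: "openin (body M) U" and oW: "open W"
    and iso: "superspace_iso (open_subspace M U) (superdomain q W) \<phi> \<psi>"
    by (auto simp: supercoordinates_def)
  interpret ring ?A using assms(1) oU by (rule superspace_ring)
  have mod: "Module.module real_field ?A"
    using superspace_superalgebra[OF assms(1) oU] by (simp add: superalgebra_def)
  have "homeomorphic_map (subtopology (body M) U) (top_of_set W) \<phi>"
    using iso by (simp add: superspace_iso_def open_subspace_def superdomain_def)
  then have "\<phi> ` topspace (subtopology (body M) U) = topspace (top_of_set W)"
    by (rule homeomorphic_imp_surjective_map)
  then have img: "\<phi> ` U = W" using openin_subset[OF oU] by (simp add: inf_absorb2)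
  \<comment> \<open>Hence \<open>\<psi> W\<close> takes values in the sections over \<open>U\<close>
    itself.\<close>
  have pre: "preim (open_subspace M U) \<phi> W = U"
    using img openin_subset[OF oU] by (auto simp: preim_def open_subspace_def)
  have oWW: "openin (body (superdomain q W)) W" by (simp add: superdomain_def)
  with iso have hom: "\<psi> W \<in> superalgebra_hom ?B (homog (superdomain q W) W) ?A (homog M U)"
    and bij: "bij_betw (\<psi> W) (carrier ?B) (carrier ?A)"
    unfolding superspace_iso_def
    by (auto simp: superdomain_def open_subspace_def pre[unfolded open_subspace_def])
  have f: "?f \<in> carrier ?B" by (rule even_section_closed[OF oW Cinf_on_coordinate])
  have e: "?e c \<in> carrier ?B" for c by (rule even_section_closed[OF oW Cinf_on_const])
  have "d_even q W t W ?f = ?e 1"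
    unfolding d_even_even_section[OF oW Cinf_on_coordinate]
    by (simp add: partial_deriv_coordinate[abs_def] even_section_def)
  then have Pf: "P U (\<psi> W ?f) = \<psi> W (?e 1)"
    using P oWW f unfolding vf_in_coordinates_def by (auto simp: pre superdomain_def)
  have "?e 1 \<oplus>\<^bsub>?B\<^esub> ?e 1 = ?e 2"
    by (intro ext) (simp add: superdomain_algebra_def even_section_def)
  then have two: "\<psi> W (?e 1) \<oplus>\<^bsub>?A\<^esub> \<psi> W (?e 1) = \<psi> W (?e 2)"
    using hom e ring_hom_add[of "\<psi> W" ?B ?A "?e 1" "?e 1"] by (simp add: superalgebra_hom_def)
  \<comment> \<open>Preservation of zero is not among the defining conditions of
    \<open>superalgebra_hom\<close>; it is derived from compatibility with the scalar
    \<open>0\<close>.\<close>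
  have "?e 0 = 0 \<odot>\<^bsub>?B\<^esub> ?e 1"
    by (intro ext) (simp add: superdomain_algebra_def even_section_def)
  then have "\<psi> W (?e 0) = 0 \<odot>\<^bsub>?A\<^esub> \<psi> W (?e 1)"
    using hom e by (simp add: superalgebra_hom_def)
  also have "\<dots> = \<zero>\<^bsub>?A\<^esub>"
    using Module.module.smult_l_null[OF mod, of "\<psi> W (?e 1)"] bij_betwE[OF bij] e
    by (simp add: real_field_def)
  finally have zero: "\<psi> W (?e 0) = \<zero>\<^bsub>?A\<^esub>" .
  obtain x where "x \<in> W" using img assms(3) by blast
  then have "?e 2 {} x \<noteq> ?e 0 {} x" by (simp add: even_section_def)
  then have "?e 2 \<noteq> ?e 0" by metis
  then have "\<psi> W (?e 2) \<noteq> \<psi> W (?e 0)"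
    using bij_betw_imp_inj_on[OF bij] e by (meson inj_onD)
  then have "P U (\<psi> W ?f) \<oplus>\<^bsub>?A\<^esub> P U (\<psi> W ?f) \<noteq> \<zero>\<^bsub>?A\<^esub>" by (simp add: Pf two zero)
  moreover have "\<psi> W ?f \<in> carrier ?A" using bij_betwE[OF bij] f by blast
  ultimately show ?thesis using that by blast
qed

section \<open>Torsion of a supersymmetry compatible connection\<close>

theorem proposition2p7:
  fixes M :: "('m, 's) superspace"
    and g :: "('m, 's) vf \<Rightarrow> ('m, 's) vf \<Rightarrow> 's"
    and Q P :: "('m, 's) vf"
    and nabla :: "('m, 's) vf \<Rightarrow> ('m, 's) vf \<Rightarrow> ('m, 's) vf"
  assumes "super_null_riemannian TYPE('n::finite) M g Q P"
    and "affine_connection M nabla"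
    and "supersymmetry_compatible M Q nabla"
  shows "\<not> torsionless M nabla"
proof
  assume tl: "torsionless M nabla"
  have M: "superspace M" and Q: "Q \<in> homog_vect M 1" and P: "P \<in> homog_vect M 0"
    and QQ: "vf_bracket M 1 1 Q Q = vf_add M P P"
    and ker: "metric_ker M g = vf_span M Q" and deg: "metric_ker M g \<noteq> {vf_zero M}"
    and sh: "\<And>m. m \<in> topspace (body M) \<Longrightarrow> shander_around TYPE('n) M Q P m"
    using assms(1) by (auto simp: super_null_riemannian_def supermanifold_def)
  have "topspace (body M) \<noteq> {}" using vf_span_empty_body[OF M _ Q] ker deg by auto
  then obtain m where "m \<in> topspace (body M)" by blast
  from sh[OF this] obtain U and W :: "(real^'n) set" and \<phi> \<psi> t
    where mU: "m \<in> U" and coords: "supercoordinates 1 M U W \<phi> \<psi>"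
      and Pc: "vf_in_coordinates M U W \<phi> \<psi> 1 P (d_even 1 W t)"
    unfolding shander_around_def by blast
  have oU: "openin (body M) U" using coords by (simp add: supercoordinates_def)
  interpret ring "sections M U" using M oU by (rule superspace_ring)
  from mU have "U \<noteq> {}" by blast
  from supercoordinates_d_even_double_nonzero[OF M coords this Pc]
  obtain f where f: "f \<in> carrier (sections M U)"
    and nz: "P U f \<oplus>\<^bsub>sections M U\<^esub> P U f \<noteq> \<zero>\<^bsub>sections M U\<^esub>" by blast
  have "Q \<in> Vect M" using homog_vect_in_span[OF M Q] ker by (auto simp: metric_ker_def)
  then have "nabla Q Q = vf_zero M"
    using assms(3) by (simp add: supersymmetry_compatible_def)
  moreover have "torsion M nabla 1 1 Q Q = vf_zero M"
    using tl Q by (simp add: torsionless_def)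
  \<comment> \<open>For two odd arguments the sign is negative, so the torsion contains
    \<open>nabla Q Q\<close> twice. Both copies vanish, and evaluation at \<open>f\<close> leaves
    minus the double of \<open>P U f\<close>.\<close>
  ultimately have "vf_diff M (vf_diff M (vf_zero M) (vf_ksign M 1 (vf_zero M))) (vf_add M P P) U f
      = vf_zero M U f"
    by (simp add: torsion_def QQ)
  then have "\<ominus>\<^bsub>sections M U\<^esub> (P U f \<oplus>\<^bsub>sections M U\<^esub> P U f) = \<zero>\<^bsub>sections M U\<^esub>"
    using oU f homog_vect_closed[OF P oU f]
    by (simp add: vf_diff_def vf_zero_def vf_ksign_def vf_add_def on_sections_def ksign_def
        minus_eq)
  then have "P U f \<oplus>\<^bsub>sections M U\<^esub> P U f = \<zero>\<^bsub>sections M U\<^esub>"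
    using homog_vect_closed[OF P oU f] by (metis add.inv_eq_1_iff add.m_closed)
  with nz show False by contradiction
qed

end
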